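(* Let $\hat{\mathcal{Q}}$ denote the set of all global real pessimistic solutions of the bilevel problem and assume that $\hat{\mathcal{Q}}$ is nonempty. Define $$\hat{\mathcal{T}}=\{x\in\hat{\mathcal{Q}} \mid \text{there exists } y\in\psi(x) \text{ with } F_p(x)=F(x,y)\}.$$ (I) If $\hat{\mathcal{Q}}\setminus\hat{\mathcal{T}}=\emptyset$, then every point of $\hat{\mathcal{Q}}$ is a global $u$-minimal solution of the set-valued formulation. (II) If $\hat{\mathcal{Q}}\setminus\hat{\mathcal{T}}\neq\emptyset$, then every point of $\hat{\mathcal{Q}}\setminus\hat{\mathcal{T}}$ is a global $u$-minimal solution of the set-valued formulation, and no element of $\hat{\mathcal{T}}$ is a global $u$-minimal solution of the set-valued formulation.
   Context: Setting. $\mathcal{X},\mathcal{Y}$ are real normed linear spaces, $X\subseteq\mathcal{X}$ is nonempty, $F:\mathcal{X}\times\mathcal{Y}\to\mathbb{R}$ is the upper-level objective. For each $x\in X$, $K(x)\subseteq\mathcal{Y}$ is the lower-level constraint set, $f$ is the real-valued lower-level objective, and $\psi(x)=\arg\min_y\{f(x,y)\mid y\in K(x)\}$ is the set of global minimizers of $f(x,\cdot)$ over $K(x)$. Standing assumption: $\psi(x)\neq\emptyset$ for every $x\in X$. The bilevel problem is: "minimize" over $x$ the value $F(x,y)$ subject to $x\in X$, $y\in\psi(x)$. $F_p(x)=\sup_{y\in\psi(x)}F(x,y)$ for $x\in X$ (possibly $+\infty$; attainment is not assumed). A point $x^*\in X$ is a global real pessimistic solution of the bilevel problem if $F_p(x)\ge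 F_p(x^* )$ for all $x\in X$. Set-valued formulation: minimize $F(x,\psi(x))$ over $x\in X$, where $F(x,\psi(x)):=\{F(x,y)\mid y\in\psi(x)\}\subseteq\mathbb{R}$. $\mathbb{R}$ carries its usual order, induced by the cone $C=\mathbb{R}_+=[0,\infty)$. For nonempty $A,B\subseteq\mathbb{R}$, $A\le_C^u B$ means $A\subseteq B-C$. A point $x^0\in X$ is a global $u$-minimal solution of the set-valued formulation if for every $x\in X$ with $F(x,\psi(x))\le_C^u F(x^0,\psi(x^0))$ one has $F(x^0,\psi(x^0))\le_C^u F(x,\psi(x))$. *)

theory Defs
  imports "HOL-Analysis.Analysis"
begin

definition lower_solutions ::
    "('x \<Rightarrow> 'y set) \<Rightarrow> ('x \<Rightarrow> 'y \<Rightarrow> real) \<Rightarrow> 'x \<Rightarrow> 'y set" where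
  "lower_solutions K f x = {y. is_arg_min (f x) (\<lambda>y. y \<in> K x) y}"

definition pessimistic_value ::
    "('x \<Rightarrow> 'y \<Rightarrow> real) \<Rightarrow> ('x \<Rightarrow> 'y set) \<Rightarrow> 'x \<Rightarrow> ereal" where
  "pessimistic_value F \<psi> x = (SUP y\<in>\<psi> x. ereal (F x y))"

definition global_pessimistic_solution ::
    "'x set \<Rightarrow> ('x \<Rightarrow> 'y \<Rightarrow> real) \<Rightarrow> ('x \<Rightarrow> 'y set) \<Rightarrow> 'x \<Rightarrow> bool" where
  "global_pessimistic_solution X F \<psi> xs \<longleftrightarrow>
     xs \<in> X \<and> (\<forall>x\<in>X. pessimistic_value F \<psi> x \<ge> pessimistic_value F \<psi> xs)"

definition u_less_eq :: "'a::ab_group_add set \<Rightarrow> 'a set \<Rightarrow> 'a set \<Rightarrow> bool" where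
  "u_less_eq C A B \<longleftrightarrow> A \<subseteq> {b - c |b c. b \<in> B \<and> c \<in> C}"

definition global_u_minimal ::
    "'a::ab_group_add set \<Rightarrow> 'x set \<Rightarrow> ('x \<Rightarrow> 'a set) \<Rightarrow> 'x \<Rightarrow> bool" where
  "global_u_minimal C X H x0 \<longleftrightarrow>
     x0 \<in> X \<and> (\<forall>x\<in>X. u_less_eq C (H x) (H x0) \<longrightarrow> u_less_eq C (H x0) (H x))"

definition bilevel_u_minimal ::
    "'x set \<Rightarrow> ('x \<Rightarrow> 'y \<Rightarrow> real) \<Rightarrow> ('x \<Rightarrow> 'y set) \<Rightarrow> 'x \<Rightarrow> bool" where
  "bilevel_u_minimal X F \<psi> = global_u_minimal {0..} X (\<lambda>x. F x ` \<psi> x)"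

end

theory Submission
  imports Defs
begin

text \<open>
  For sets of reals, \<open>A \<subseteq> B - [0,\<infinity>)\<close> means that every element of \<open>A\<close> lies below some element
  of \<open>B\<close>. Whether this happens depends on only two data of each set: its supremum, and whether
  that supremum is attained. The comparison is lexicographic: a smaller supremum wins, and among
  sets with equal suprema the unattained ones lie below the attained ones
  (\<open>u_less_eq_iff_pessimistic\<close>).

  Pessimistic solutions are exactly the points of \<open>X\<close> whose value set has the smallest supremum.
  Hence the \<open>u\<close>-minimal points are those pessimistic solutions that also minimise the second
  component: all of them if every pessimistic solution attains its value, and otherwise only
  those that do not attain it.
\<close>

definition pessimistic_attained ::
    "('x \<Rightarrow> 'y \<Rightarrow> real) \<Rightarrow> ('x \<Rightarrow> 'y set) \<Rightarrow> 'x \<Rightarrow> bool" where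
  "pessimistic_attained F \<psi> x \<longleftrightarrow> (\<exists>y\<in>\<psi> x. pessimistic_value F \<psi> x = ereal (F x y))"

lemma u_less_eq_real_iff:
  fixes A B :: "real set"
  shows "u_less_eq {0..} A B \<longleftrightarrow> (\<forall>a\<in>A. \<exists>b\<in>B. a \<le> b)"
proof -
  have "(\<exists>b c. a = b - c \<and> b \<in> B \<and> c \<in> {0..}) \<longleftrightarrow> (\<exists>b\<in>B. a \<le> b)" for a
  proof
    assume "\<exists>b\<in>B. a \<le> b"
    then obtain b where "b \<in> B" "a \<le> b" by blast
    then have "a = b - (b - a) \<and> b \<in> B \<and> b - a \<in> {0..}" by simp
    then show "\<exists>b c. a = b - c \<and> b \<in> B \<and> c \<in> {0..}" by blast
  qed (metis atLeast_iff diff_le_eq le_add_same_cancel1)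
  then show ?thesis
    unfolding u_less_eq_def by blast
qed

lemma pessimistic_value_upper:
  "y \<in> \<psi> x \<Longrightarrow> ereal (F x y) \<le> pessimistic_value F \<psi> x"
  unfolding pessimistic_value_def by (rule SUP_upper)

lemma pessimistic_value_mono_u:
  assumes "u_less_eq {0..} (F z ` \<psi> z) (F x ` \<psi> x)"
  shows "pessimistic_value F \<psi> z \<le> pessimistic_value F \<psi> x"
  using assms unfolding u_less_eq_real_iff pessimistic_value_def
  by (intro SUP_mono) auto

text \<open>
  If the suprema agree and the left one is attained, an element dominating that maximum
  cannot exceed the common supremum, so it attains the right one. Conversely, an element strictly
  below the right supremum is dominated by the approximation property of suprema; the only element
  that may fail to be strictly below is an attained common supremum, and it is dominated by the
  right maximum. Empty sets fit in with supremum \<open>-\<infinity>\<close>, unattained.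
\<close>

lemma u_less_eq_iff_pessimistic:
  "u_less_eq {0..} (F z ` \<psi> z) (F x ` \<psi> x) \<longleftrightarrow>
     pessimistic_value F \<psi> z < pessimistic_value F \<psi> x \<or>
     (pessimistic_value F \<psi> z = pessimistic_value F \<psi> x \<and>
      (pessimistic_attained F \<psi> z \<longrightarrow> pessimistic_attained F \<psi> x))"
  (is "?less \<longleftrightarrow> ?Vz < ?Vx \<or> (?Vz = ?Vx \<and> ?att)")
proof
  assume less: ?less
  have ?att if eq: "?Vz = ?Vx"
  proof
    assume "pessimistic_attained F \<psi> z"
    then obtain y where y: "y \<in> \<psi> z" "?Vz = ereal (F z y)"
      unfolding pessimistic_attained_def by blast
    with less obtain y' where y': "y' \<in> \<psi> x" "F z y \<le> F x y'"
      unfolding u_less_eq_real_iff by auto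
    with y eq have "?Vx \<le> ereal (F x y')" by simp
    then have "?Vx = ereal (F x y')"
      using pessimistic_value_upper[where \<psi> = \<psi>, OF y'(1), of F] by (rule antisym)
    with y'(1) show "pessimistic_attained F \<psi> x"
      unfolding pessimistic_attained_def by blast
  qed
  with pessimistic_value_mono_u[OF less] show "?Vz < ?Vx \<or> (?Vz = ?Vx \<and> ?att)"
    by (auto simp: less_le)
next
  assume lex: "?Vz < ?Vx \<or> (?Vz = ?Vx \<and> ?att)"
  have "\<exists>y'\<in>\<psi> x. F z y \<le> F x y'" if y: "y \<in> \<psi> z" for y
  proof (cases "ereal (F z y) < ?Vx")
    case True
    then obtain y' where "y' \<in> \<psi> x" "ereal (F z y) < ereal (F x y')"
      unfolding pessimistic_value_def less_SUP_iff by blast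
    then show ?thesis by (auto intro: less_imp_le)
  next
    case False
    with lex pessimistic_value_upper[where \<psi> = \<psi>, OF y, of F]
    have eq: "?Vz = ereal (F z y)" "?Vz = ?Vx" and ?att
      by auto
    with y obtain y' where "y' \<in> \<psi> x" "?Vx = ereal (F x y')"
      unfolding pessimistic_attained_def by blast
    with eq show ?thesis by (auto intro!: bexI[of _ y'])
  qed
  then show ?less
    unfolding u_less_eq_real_iff by auto
qed

text \<open>
  Minimality for the lexicographic order: among pessimistic solutions, which share the smallest
  value, only the attainment flag is left to minimise.
\<close>

lemma pessimistic_solution_u_minimal_iff:
  assumes x0: "global_pessimistic_solution X F \<psi> x0"
  shows "bilevel_u_minimal X F \<psi> x0 \<longleftrightarrow>
    (pessimistic_attained F \<psi> x0 \<longrightarrow>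
      (\<forall>x. global_pessimistic_solution X F \<psi> x \<longrightarrow> pessimistic_attained F \<psi> x))"
proof -
  have x0X: "x0 \<in> X"
    and le: "\<And>x. x \<in> X \<Longrightarrow> pessimistic_value F \<psi> x0 \<le> pessimistic_value F \<psi> x"
    using x0 unfolding global_pessimistic_solution_def by auto
  have sol: "global_pessimistic_solution X F \<psi> x \<longleftrightarrow>
      x \<in> X \<and> pessimistic_value F \<psi> x = pessimistic_value F \<psi> x0" for x
    using x0X le unfolding global_pessimistic_solution_def by (metis antisym)
  show ?thesis
    unfolding bilevel_u_minimal_def global_u_minimal_def u_less_eq_iff_pessimistic sol
    using x0X le by (metis leD order_le_imp_less_or_eq)
qed

theorem theorem15:
  fixes X :: "'x::real_normed_vector set"
    and F :: "'x \<Rightarrow> 'y::real_normed_vector \<Rightarrow> real"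
    and K :: "'x \<Rightarrow> 'y set"
    and f :: "'x \<Rightarrow> 'y \<Rightarrow> real"
    and \<psi> :: "'x \<Rightarrow> 'y set"
    and Q T :: "'x set"
  defines "\<psi> \<equiv> lower_solutions K f"
    and "Q \<equiv> {x. global_pessimistic_solution X F \<psi> x}"
    and "T \<equiv> {x \<in> Q. \<exists>y\<in>\<psi> x. pessimistic_value F \<psi> x = ereal (F x y)}"
  assumes "X \<noteq> {}"
    and "\<And>x. x \<in> X \<Longrightarrow> \<psi> x \<noteq> {}"
    and "Q \<noteq> {}"
  shows "(Q - T = {} \<longrightarrow> (\<forall>x\<in>Q. bilevel_u_minimal X F \<psi> x)) \<and>
         (Q - T \<noteq> {} \<longrightarrow> (\<forall>x\<in>Q - T. bilevel_u_minimal X F \<psi> x) \<and>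
                      (\<forall>x\<in>T. \<not> bilevel_u_minimal X F \<psi> x))"
proof -
  have T: "x \<in> T \<longleftrightarrow> x \<in> Q \<and> pessimistic_attained F \<psi> x" for x
    unfolding T_def pessimistic_attained_def by blast
  have minimal: "bilevel_u_minimal X F \<psi> x \<longleftrightarrow> (x \<in> T \<longrightarrow> Q \<subseteq> T)" if "x \<in> Q" for x
    using that pessimistic_solution_u_minimal_iff[of X F \<psi> x] T unfolding Q_def by blast
  show ?thesis
    using minimal T by blast
qed

end
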